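(* Let $\mathcal{L}_{\mathcal{H}}$ be the Hesse arrangement of $12$ lines in $\mathbb{P}^2_{\mathbb{C}}$. The Levi graph associated to $\mathcal{L}_{\mathcal{H}}$ contains induced cycles of length $2i$ for all integers $3\le i\leq 6$, and the length of a longest induced cycle in this graph is $12$.
   Context: For a line arrangement $\mathcal{L}$ (a finite set of distinct lines in $\mathbb{P}^2_{\mathbb{C}}$), $\mathrm{Sing}(\mathcal{L})$ is the set of points lying on at least two lines of $\mathcal{L}$, and $t_r$ is the number of points of $\mathrm{Sing}(\mathcal{L})$ lying on exactly $r$ lines of $\mathcal{L}$. The Levi graph of $\mathcal{L}$ is the bipartite graph with one vertex for each point of $\mathrm{Sing}(\mathcal{L})$ and one vertex for each line of $\mathcal{L}$, a point vertex and a line vertex being adjacent iff the point lies on the line. An induced cycle is an induced subgraph that is a cycle; its length is its number of vertices. The Hesse arrangement $\mathcal{L}_{\mathcal{H}}=\{\ell_1,\dots,\ell_{12}\}$ is the arrangement of $12$ lines with $t_2=12$, $t_4=9$ and $t_r=0$ otherwise. Its incidences are as follows. The nine $4$-fold points $p_1,\dots,p_9$ lie on exactly the following lines (given by indices): $p_1:\{1,4,7,10\}$, $p_2:\{1,5,9,12\}$, $p_3:\{1,6,8,11\}$, $p_4:\{2,4,11,12\}$, $p_5:\{2,5,7,8\}$, $p_6:\{2,6,9,10\}$, $p_7:\{3,4,8,9\}$, $p_8:\{3,5,10,11\}$, $p_9:\{3,6,7,12\}$. The remaining $12$ points of $\mathrm{Sing}(\mathcal{L}_{\mathcal{H}})$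 are double points $p_{ij}$, each on exactly two lines $\ell_i,\ell_j$, where $\{i,j\}$ runs over the two-element subsets of $\{1,2,3\}$, $\{4,5,6\}$, $\{7,9,11\}$ and $\{8,10,12\}$. *)

theory Defs
  imports "HOL-Analysis.Analysis"
begin

text \<open>Points and lines of the complex projective plane are the complex subspaces of
  \<open>\<complex>\<^sup>3\<close> of dimension 1 and 2; incidence is inclusion. (The library's \<open>subspace\<close>
  and \<open>dim\<close> are over the reals; the versions in the namespace \<open>vec\<close> are over \<open>\<complex>\<close>.)\<close>

type_synonym projective_set = "(complex^3) set"

definition proj_points :: "projective_set set" where
  "proj_points = {p. vec.subspace p \<and> vec.dim p = 1}"

definition proj_lines :: "projective_set set" where
  "proj_lines = {l. vec.subspace l \<and> vec.dim l = 2}"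

definition line_arrangement :: "projective_set set \<Rightarrow> bool" where
  "line_arrangement L \<longleftrightarrow> finite L \<and> L \<subseteq> proj_lines"

definition Sing :: "projective_set set \<Rightarrow> projective_set set" where
  "Sing L = {p \<in> proj_points. 2 \<le> card {l \<in> L. p \<subseteq> l}}"

definition t_num :: "projective_set set \<Rightarrow> nat \<Rightarrow> nat" where
  "t_num L r = card {p \<in> Sing L. card {l \<in> L. p \<subseteq> l} = r}"

text \<open>A simple graph is a pair of a vertex set and a set of two-element edges.\<close>

type_synonym 'a graph = "'a set \<times> 'a set set"

definition levi_graph :: "projective_set set \<Rightarrow> (projective_set + projective_set) graph" where
  "levi_graph L = (Inl ` Sing L \<union> Inr ` L, {{Inl p, Inr l} | p l. p \<in> Sing L \<and> l \<in> L \<and> p \<subseteq> l})"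

definition induced_subgraph :: "'a graph \<Rightarrow> 'a set \<Rightarrow> 'a graph" where
  "induced_subgraph G W = (W, {e \<in> snd G. e \<subseteq> W})"

definition is_cycle :: "'a graph \<Rightarrow> bool" where
  "is_cycle G \<longleftrightarrow> (\<exists>n f. 3 \<le> n \<and> bij_betw f {..<n} (fst G) \<and>
     snd G = {{f i, f (Suc i mod n)} | i::nat. i < n})"

text \<open>An induced cycle is represented by its vertex set, so that its length is the cardinality.\<close>

definition induced_cycle :: "'a graph \<Rightarrow> 'a set \<Rightarrow> bool" where
  "induced_cycle G W \<longleftrightarrow> W \<subseteq> fst G \<and> is_cycle (induced_subgraph G W)"

definition longest_induced_cycle :: "'a graph \<Rightarrow> 'a set \<Rightarrow> bool" where
  "longest_induced_cycle G W \<longleftrightarrow>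
     induced_cycle G W \<and> (\<forall>W'. induced_cycle G W' \<longrightarrow> card W' \<le> card W)"

definition hesse_quadruples :: "nat set set" where
  "hesse_quadruples = {{1,4,7,10}, {1,5,9,12}, {1,6,8,11}, {2,4,11,12}, {2,5,7,8}, {2,6,9,10},
     {3,4,8,9}, {3,5,10,11}, {3,6,7,12}}"

definition hesse_doubles :: "nat set set" where
  "hesse_doubles =
     {{i, j} | i j T. T \<in> {{1,2,3}, {4,5,6}, {7,9,11}, {8,10,12}} \<and> i \<in> T \<and> j \<in> T \<and> i \<noteq> j}"

text \<open>The Hesse arrangement is only determined up to a projective transformation, so it is a
  property of arrangements. The bijection says that each index set in \<open>hesse_quadruples\<close> or
  \<open>hesse_doubles\<close> is the set of all (indices of) lines through exactly one singular point, and
  that there are no other singular points.\<close>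

definition hesse_arrangement :: "projective_set set \<Rightarrow> bool" where
  "hesse_arrangement L \<longleftrightarrow>
     line_arrangement L \<and> card L = 12 \<and>
     t_num L 2 = 12 \<and> t_num L 4 = 9 \<and> (\<forall>r. r \<noteq> 2 \<longrightarrow> r \<noteq> 4 \<longrightarrow> t_num L r = 0) \<and>
     (\<exists>lin :: nat \<Rightarrow> projective_set. bij_betw lin {1..12} L \<and>
        bij_betw (\<lambda>p. {i \<in> {1..12}. p \<subseteq> lin i}) (Sing L) (hesse_quadruples \<union> hesse_doubles))"

subsection \<open>Existence of a Hesse arrangement\<close>

text \<open>Computations take place in the Eisenstein integers, a pair \<open>(a, b)\<close> standing for
  \<open>a + b * w\<close> with \<open>w\<close> a primitive third root of unity.\<close>

definition w3 :: complex where "w3 = Complex (-1/2) (sqrt 3 / 2)"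

definition eis :: "int \<times> int \<Rightarrow> complex" where "eis x = of_int (fst x) + of_int (snd x) * w3"

fun emul :: "int \<times> int \<Rightarrow> int \<times> int \<Rightarrow> int \<times> int" where
  "emul (a, b) (c, d) = (a * c - b * d, a * d + b * c - b * d)"

fun edot :: "(int \<times> int) \<times> (int \<times> int) \<times> (int \<times> int) \<Rightarrow> (int \<times> int) \<times> (int \<times> int) \<times> (int \<times> int)
    \<Rightarrow> int \<times> int" where
  "edot (x, y, z) (x', y', z') =
     (fst (emul x x') + fst (emul y y') + fst (emul z z'),
      snd (emul x x') + snd (emul y y') + snd (emul z z'))"

fun evec :: "(int \<times> int) \<times> (int \<times> int) \<times> (int \<times> int) \<Rightarrow> complex^3" where
  "evec (x, y, z) = vector [eis x, eis y, eis z]"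

definition cdot :: "complex^3 \<Rightarrow> complex^3 \<Rightarrow> complex" where
  "cdot u v = u$1 * v$1 + u$2 * v$2 + u$3 * v$3"

lemma w3_sq: "w3 * w3 = -1 - w3"
  by (simp add: w3_def complex_eq_iff)

lemma eis_mul: "eis (emul x y) = eis x * eis y"
proof -
  obtain a b c d where xy: "x = (a, b)" "y = (c, d)" by fastforce
  have "eis x * eis y = of_int a * of_int c + (of_int a * of_int d + of_int b * of_int c) * w3
      + of_int b * of_int d * (w3 * w3)"
    by (simp add: eis_def xy algebra_simps)
  then show ?thesis unfolding w3_sq by (simp add: eis_def xy algebra_simps)
qed

lemma eis_eq_0: "eis x = 0 \<longleftrightarrow> x = (0, 0)"
  by (cases x) (auto simp: eis_def w3_def complex_eq_iff)

lemma cdot_evec: "cdot (evec u) (evec v) = eis (edot u v)"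
proof -
  obtain x y z x' y' z' where uv: "u = (x, y, z)" "v = (x', y', z')" by (metis prod.exhaust)
  show ?thesis
    by (simp add: uv cdot_def vector_3 eis_mul[symmetric]) (simp add: eis_def algebra_simps)
qed

lemma cdot_simps [simp]: "cdot a 0 = 0" "cdot a (u + v) = cdot a u + cdot a v"
    "cdot a (c *s u) = c * cdot a u"
  by (simp_all add: cdot_def algebra_simps)

definition kern :: "complex^3 \<Rightarrow> projective_set" where "kern a = {v. cdot a v = 0}"

lemma subspace_kern: "vec.subspace (kern a)"
  by (auto simp: vec.subspace_def kern_def)

lemma kern_line:
  assumes "a \<noteq> 0" shows "kern a \<in> proj_lines"
proof -
  obtain j where j: "a $ j \<noteq> 0" using assms by (auto simp: vec_eq_iff)
  define e :: "complex^3" where "e = axis j 1"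
  have ae: "cdot a e = a $ j"
    using exhaust_3[of j] by (auto simp: cdot_def e_def axis_def)
  have ne: "e \<notin> vec.span (kern a)"
    using j ae by (simp add: vec.span_eq_iff[THEN iffD2, OF subspace_kern]) (simp add: kern_def)
  have "v \<in> vec.span (insert e (kern a))" for v
  proof -
    have "v - (cdot a v / a $ j) *s e \<in> kern a"
      using cdot_simps(2)[of a "v - (cdot a v / a $ j) *s e" "(cdot a v / a $ j) *s e"] j ae
      by (simp add: kern_def)
    then have "v - (cdot a v / a $ j) *s e \<in> vec.span (kern a)" by (rule vec.span_base)
    then show ?thesis unfolding vec.span_insert by blast
  qed
  then have sp: "vec.span (insert e (kern a)) = UNIV" by blast
  have "vec.dim (insert e (kern a)) = 3"
    using vec.dim_span[of "insert e (kern a)"] unfolding sp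
    by (simp add: vec.dim_UNIV vec.dimension_def card_cart_basis)
  then have "vec.dim (kern a) = 2" using ne by (simp add: vec.dim_insert)
  then show ?thesis by (simp add: proj_lines_def subspace_kern)
qed

definition hlines :: "((int \<times> int) \<times> (int \<times> int) \<times> (int \<times> int)) list" where
  "hlines = [((1,0),(0,0),(0,0)), ((0,0),(1,0),(0,0)), ((0,0),(0,0),(1,0)),
     ((1,0),(1,0),(1,0)), ((1,0),(0,1),(-1,-1)), ((1,0),(-1,-1),(0,1)),
     ((1,0),(-1,-1),(-1,-1)), ((1,0),(1,0),(-1,-1)), ((1,0),(1,0),(0,1)),
     ((1,0),(0,1),(0,1)), ((1,0),(0,1),(1,0)), ((1,0),(-1,-1),(1,0))]"

text \<open>For each singular point, the indices of the lines through it and a vector spanning it.\<close>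

definition hpoints :: "(nat list \<times> ((int \<times> int) \<times> (int \<times> int) \<times> (int \<times> int))) list" where
  "hpoints = [([1, 4, 7, 10], ((0,0),(1,0),(-1,0))),
     ([1, 5, 9, 12], ((0,0),(1,0),(1,1))),
     ([1, 6, 8, 11], ((0,0),(1,0),(0,-1))),
     ([2, 4, 11, 12], ((1,0),(0,0),(-1,0))),
     ([2, 5, 7, 8], ((1,0),(0,0),(0,-1))),
     ([2, 6, 9, 10], ((1,0),(0,0),(1,1))),
     ([3, 4, 8, 9], ((1,0),(-1,0),(0,0))),
     ([3, 5, 10, 11], ((1,0),(1,1),(0,0))),
     ([3, 6, 7, 12], ((1,0),(0,-1),(0,0))),
     ([1, 2], ((0,0),(0,0),(1,0))),
     ([1, 3], ((0,0),(1,0),(0,0))),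
     ([2, 3], ((1,0),(0,0),(0,0))),
     ([4, 5], ((1,0),(0,1),(-1,-1))),
     ([4, 6], ((1,0),(-1,-1),(0,1))),
     ([5, 6], ((1,0),(1,0),(1,0))),
     ([7, 9], ((1,0),(-1,-1),(1,0))),
     ([7, 11], ((1,0),(1,0),(-1,-1))),
     ([9, 11], ((1,0),(0,1),(0,1))),
     ([8, 10], ((1,0),(0,1),(1,0))),
     ([8, 12], ((1,0),(-1,-1),(-1,-1))),
     ([10, 12], ((1,0),(1,0),(0,1)))]"

definition hl :: "nat \<Rightarrow> projective_set" where "hl i = kern (evec (hlines ! (i - 1)))"

definition hp :: "nat \<Rightarrow> projective_set" where "hp k = vec.span {evec (snd (hpoints ! k))}"

lemma hcheck:
  "\<forall>k\<in>set [0..<21]. \<forall>i\<in>set [1..<13].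
     (edot (hlines ! (i - 1)) (snd (hpoints ! k)) = (0, 0)) = (i \<in> set (fst (hpoints ! k)))"
  by code_simp

lemma hnonzero: "\<forall>x\<in>set (hlines @ map snd hpoints). x \<noteq> ((0,0),(0,0),(0,0))"
  by code_simp

lemma hblock_unique: "\<forall>i\<in>set [1..<13]. \<forall>j\<in>set [1..<13]. i \<noteq> j \<longrightarrow>
    length (filter (\<lambda>k. i \<in> set (fst (hpoints ! k)) \<and> j \<in> set (fst (hpoints ! k))) [0..<21]) = 1"
  by code_simp

lemma hblock_set: "set (map (set \<circ> fst) hpoints) = hesse_quadruples \<union> hesse_doubles"
proof -
  have g: "{{i, j} | i j T. T \<in> A \<and> i \<in> T \<and> j \<in> T \<and> i \<noteq> j} = (\<Union>T\<in>A. \<Union>i\<in>T. \<Union>j\<in>T - {i}. {{i, j}})"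
    for A :: "nat set set"
    by blast
  have d: "hesse_doubles = (\<Union>T\<in>{{1,2,3}, {4,5,6}, {7,9,11}, {8,10,12}}. \<Union>i\<in>T. \<Union>j\<in>T - {i}. {{i, j}})"
    unfolding hesse_doubles_def by (rule g)
  then show ?thesis
    unfolding hesse_quadruples_def d by code_simp
qed

lemma hline_separated: "\<forall>i\<in>set [1..<13]. \<forall>j\<in>set [1..<13]. i \<noteq> j \<longrightarrow>
    list_ex (\<lambda>k. i \<in> set (fst (hpoints ! k)) \<and> j \<notin> set (fst (hpoints ! k))) [0..<21]"
  by code_simp

lemma hblock_range: "list_all (\<lambda>x. distinct (fst x) \<and> set (fst x) \<subseteq> set [1..<13] \<and>
    (length (fst x) = 2 \<or> length (fst x) = 4)) hpoints"
  by code_simp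

lemma hblock_count:
    "card (Set.filter (\<lambda>B. card B = 2) (set (map (set \<circ> fst) hpoints))) = 12"
    "card (Set.filter (\<lambda>B. card B = 4) (set (map (set \<circ> fst) hpoints))) = 9"
  by code_simp+

lemma evec_nonzero: "x \<noteq> ((0,0),(0,0),(0,0)) \<Longrightarrow> evec x \<noteq> 0"
  by (cases x) (auto simp: vec_eq_iff forall_3 vector_3 eis_eq_0)

abbreviation hblock :: "nat \<Rightarrow> nat set" where "hblock k \<equiv> set (fst (hpoints ! k))"

lemma length_h: "length hlines = 12" "length hpoints = 21"
  by (simp_all add: hlines_def hpoints_def)

lemma hl_line: "i \<in> {1..12} \<Longrightarrow> hl i \<in> proj_lines"
  unfolding hl_def
  by (rule kern_line, rule evec_nonzero, rule hnonzero[rule_format]) (auto simp: length_h)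

lemma hp_point:
  assumes "k < 21" shows "hp k \<in> proj_points"
proof -
  have "snd (hpoints ! k) \<in> set (hlines @ map snd hpoints)"
    using assms by (auto simp: length_h)
  then have "evec (snd (hpoints ! k)) \<noteq> 0" using hnonzero evec_nonzero by blast
  then show ?thesis
    by (simp add: hp_def proj_points_def vec.dim_span_eq_card_independent vec.dim_eq_card_independent)
qed

lemma hp_hl:
  assumes "k < 21" "i \<in> {1..12}" shows "hp k \<subseteq> hl i \<longleftrightarrow> i \<in> hblock k"
proof -
  have "hp k \<subseteq> hl i \<longleftrightarrow> evec (snd (hpoints ! k)) \<in> hl i"
    unfolding hp_def using vec.span_base vec.span_minimal[OF _ subspace_kern]
    unfolding hl_def by blast
  also have "\<dots> \<longleftrightarrow> edot (hlines ! (i - 1)) (snd (hpoints ! k)) = (0, 0)"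
    by (simp add: hl_def kern_def cdot_evec eis_eq_0)
  also have "\<dots> \<longleftrightarrow> i \<in> hblock k"
    using hcheck assms by auto
  finally show ?thesis .
qed

lemma two_lines_meet_once:
  assumes "l \<in> proj_lines" "m \<in> proj_lines" "l \<noteq> m" "p \<in> proj_points" "q \<in> proj_points"
    and "p \<subseteq> l" "p \<subseteq> m" "q \<subseteq> l" "q \<subseteq> m"
  shows "p = q"
proof -
  have s: "vec.subspace l" "vec.subspace m" "vec.dim l = 2" "vec.dim m = 2"
    using assms by (auto simp: proj_lines_def)
  have si: "vec.subspace (l \<inter> m)" by (rule vec.subspace_inter) (fact s)+
  have "vec.dim (l \<inter> m) \<le> 1"
  proof (rule ccontr)
    assume "\<not> ?thesis"
    then have "l \<inter> m = l" "l \<inter> m = m"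
      using vec.subspace_dim_equal[OF si s(1)] vec.subspace_dim_equal[OF si s(2)] s by auto
    with \<open>l \<noteq> m\<close> show False by simp
  qed
  then have "r = l \<inter> m" if "r \<in> proj_points" "r \<subseteq> l" "r \<subseteq> m" for r
    using that vec.subspace_dim_equal[OF _ si, of r] by (auto simp: proj_points_def)
  then show ?thesis using assms by metis
qed

lemma hl_inj: "inj_on hl {1..12}"
proof (rule inj_onI, rule ccontr)
  fix i j :: nat assume ij: "i \<in> {1..12}" "j \<in> {1..12}" "hl i = hl j" "i \<noteq> j"
  then have "list_ex (\<lambda>k. i \<in> hblock k \<and> j \<notin> hblock k) [0..<21]"
    using hline_separated by auto
  then obtain k where "k < 21" "i \<in> hblock k" "j \<notin> hblock k" by (auto simp: list_ex_iff)
  then show False using hp_hl ij by metis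
qed

lemma hp_in_Sing:
  assumes "k < 21" shows "hp k \<in> Sing (hl ` {1..12})" "{i \<in> {1..12}. hp k \<subseteq> hl i} = hblock k"
proof -
  have b: "distinct (fst (hpoints ! k)) \<and> hblock k \<subseteq> {1..12} \<and>
      (length (fst (hpoints ! k)) = 2 \<or> length (fst (hpoints ! k)) = 4)"
    using hblock_range assms
    by (simp add: list_all_length length_h atLeastLessThanSuc_atLeastAtMost[of 1 12, simplified, symmetric])
  then show eq: "{i \<in> {1..12}. hp k \<subseteq> hl i} = hblock k" using hp_hl[OF assms] by blast
  have "{l \<in> hl ` {1..12}. hp k \<subseteq> l} = hl ` {i \<in> {1..12}. hp k \<subseteq> hl i}" by auto
  then have "card {l \<in> hl ` {1..12}. hp k \<subseteq> l} = card (hblock k)"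
    unfolding eq using card_image[OF inj_on_subset[OF hl_inj, of "hblock k"]] b by (simp only:)
  then show "hp k \<in> Sing (hl ` {1..12})"
    using b hp_point[OF assms] distinct_card[of "fst (hpoints ! k)"] by (auto simp: Sing_def)
qed

lemma Sing_two:
  assumes "p \<in> Sing (hl ` {1..12})"
  obtains i j where "i \<in> {1..12}" "j \<in> {1..12}" "i \<noteq> j" "p \<subseteq> hl i" "p \<subseteq> hl j"
proof -
  have "2 \<le> card {l \<in> hl ` {1..12}. p \<subseteq> l}" using assms by (simp add: Sing_def)
  then obtain T where T: "T \<subseteq> {l \<in> hl ` {1..12}. p \<subseteq> l}" "card T = 2"
    by (rule obtain_subset_with_card_n) blast
  then obtain l m where "T = {l, m}" "l \<noteq> m" by (auto simp: card_2_iff)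
  with T have "l \<in> hl ` {1..12}" "m \<in> hl ` {1..12}" "l \<noteq> m" "p \<subseteq> l" "p \<subseteq> m" by auto
  then show ?thesis using that by blast
qed

lemma Sing_point: "p \<in> Sing L \<Longrightarrow> p \<in> proj_points"
  by (simp add: Sing_def)

lemma Sing_hp:
  assumes "p \<in> Sing (hl ` {1..12})"
  obtains k where "k < 21" "p = hp k"
proof -
  obtain i j where ij: "i \<in> {1..12}" "j \<in> {1..12}" "i \<noteq> j" "p \<subseteq> hl i" "p \<subseteq> hl j"
    using Sing_two[OF assms] .
  then have "length (filter (\<lambda>k. i \<in> hblock k \<and> j \<in> hblock k) [0..<21]) = 1"
    using hblock_unique by auto
  then have "filter (\<lambda>k. i \<in> hblock k \<and> j \<in> hblock k) [0..<21] \<noteq> []" by force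
  then obtain k where k: "k < 21" "i \<in> hblock k" "j \<in> hblock k"
    by (auto simp: filter_empty_conv)
  have "p = hp k"
    using two_lines_meet_once[of "hl i" "hl j" p "hp k"] ij k hp_hl hl_line hp_point Sing_point[OF assms]
      inj_onD[OF hl_inj] by metis
  with k that show ?thesis by blast
qed

lemma hl_incidence:
  "bij_betw (\<lambda>p. {i \<in> {1..12}. p \<subseteq> hl i}) (Sing (hl ` {1..12})) (hesse_quadruples \<union> hesse_doubles)"
  unfolding bij_betw_def
proof
  show "inj_on (\<lambda>p. {i \<in> {1..12}. p \<subseteq> hl i}) (Sing (hl ` {1..12}))"
  proof (rule inj_onI)
    fix p q assume p: "p \<in> Sing (hl ` {1..12})" and q: "q \<in> Sing (hl ` {1..12})"
      and eq: "{i \<in> {1..12}. p \<subseteq> hl i} = {i \<in> {1..12}. q \<subseteq> hl i}"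
    obtain i j where ij: "i \<in> {1..12}" "j \<in> {1..12}" "i \<noteq> j" "p \<subseteq> hl i" "p \<subseteq> hl j"
      using Sing_two[OF p] .
    then have "q \<subseteq> hl i" "q \<subseteq> hl j" using eq by blast+
    then show "p = q"
      using two_lines_meet_once[of "hl i" "hl j" p q] ij hl_line Sing_point[OF p] Sing_point[OF q]
        inj_onD[OF hl_inj] by metis
  qed
  have "Sing (hl ` {1..12}) = hp ` {..<21}"
  proof (intro equalityI subsetI)
    fix p assume "p \<in> Sing (hl ` {1..12})"
    then obtain k where "k < 21" "p = hp k" by (rule Sing_hp)
    then show "p \<in> hp ` {..<21}" by blast
  next
    fix p assume "p \<in> hp ` {..<21}"
    then obtain k where "k < 21" "p = hp k" by blast
    then show "p \<in> Sing (hl ` {1..12})" using hp_in_Sing(1) by blast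
  qed
  then have "(\<lambda>p. {i \<in> {1..12}. p \<subseteq> hl i}) ` Sing (hl ` {1..12}) = hblock ` {..<21}"
    using hp_in_Sing(2) by (simp add: image_image)
  also have "\<dots> = set (map (set \<circ> fst) hpoints)"
  proof -
    have "set hpoints = (\<lambda>k. hpoints ! k) ` {..<21}"
      unfolding set_conv_nth length_h by blast
    then show ?thesis by (simp add: image_image)
  qed
  finally show "(\<lambda>p. {i \<in> {1..12}. p \<subseteq> hl i}) ` Sing (hl ` {1..12}) = hesse_quadruples \<union> hesse_doubles"
    using hblock_set by simp
qed

lemma t_num_hl: "t_num (hl ` {1..12}) r = card {B \<in> hesse_quadruples \<union> hesse_doubles. card B = r}"
proof -
  let ?I = "\<lambda>p. {i \<in> {1..12}. p \<subseteq> hl i}"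
  have c: "card {l \<in> hl ` {1..12}. p \<subseteq> l} = card (?I p)" for p
  proof -
    have "{l \<in> hl ` {1..12}. p \<subseteq> l} = hl ` ?I p" by auto
    moreover have "card (hl ` ?I p) = card (?I p)"
      by (rule card_image[OF inj_on_subset[OF hl_inj]]) blast
    ultimately show ?thesis by simp
  qed
  have "?I ` {p \<in> Sing (hl ` {1..12}). card (?I p) = r} = {B \<in> ?I ` Sing (hl ` {1..12}). card B = r}"
    by blast
  moreover have "inj_on ?I {p \<in> Sing (hl ` {1..12}). card (?I p) = r}"
    using hl_incidence by (auto simp only: bij_betw_def elim: inj_on_subset)
  ultimately have "bij_betw ?I {p \<in> Sing (hl ` {1..12}). card (?I p) = r}
      {B \<in> hesse_quadruples \<union> hesse_doubles. card B = r}"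
    using hl_incidence unfolding bij_betw_def by simp
  then show ?thesis unfolding t_num_def c by (rule bij_betw_same_card)
qed

lemma hesse_arrangement_exists: "\<exists>L. hesse_arrangement L"
proof
  have "card B = 2 \<or> card B = 4" if "B \<in> set (map (set \<circ> fst) hpoints)" for B
    using that hblock_range by (auto simp: list_all_iff distinct_card)
  then have "{B \<in> hesse_quadruples \<union> hesse_doubles. card B = r} = {}" if "r \<noteq> 2" "r \<noteq> 4" for r
    using that unfolding hblock_set by blast
  then have t: "t_num (hl ` {1..12}) r = 0" if "r \<noteq> 2" "r \<noteq> 4" for r
    unfolding t_num_hl using that by (metis card.empty)
  have "t_num (hl ` {1..12}) 2 = 12" "t_num (hl ` {1..12}) 4 = 9"
    using hblock_count unfolding t_num_hl hblock_set Set.filter_eq by blast+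
  moreover have "card (hl ` {1..12}) = 12" using card_image[OF hl_inj] by simp
  moreover have "line_arrangement (hl ` {1..12})"
    using hl_line by (auto simp: line_arrangement_def)
  ultimately show "hesse_arrangement (hl ` {1..12})"
    unfolding hesse_arrangement_def using t hl_incidence hl_inj by (blast intro: bij_betw_imageI)
qed

end

theory Submission
  imports Defs "HOL-Number_Theory.Cong"
begin

text \<open>A cycle in a Levi graph alternates between lines and points, so it amounts to a cyclic sequence
  of \<open>k\<close> distinct lines, and it is induced iff the intersection point of any two consecutive lines
  lies on no third line of the sequence. For the Hesse arrangement the lines \<open>1, \<dots>, k\<close> in
  this order do the job for \<open>3 \<le> k \<le> 6\<close>. That no such sequence has seven or more lines
  is a finite check: starting from the line of smallest index, the open sequences with this property
  have at most eight lines, and none of those with seven or eight lines closes up.\<close>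

section \<open>Induced cycles of the Levi graph as cyclic sequences of lines\<close>

abbreviation hesse_blocks :: "nat set set" where
  "hesse_blocks \<equiv> hesse_quadruples \<union> hesse_doubles"

text \<open>The sequence \<open>m\<close> is \<open>k\<close>-periodic, which makes it easy to choose its starting point.\<close>

definition line_cycle :: "nat \<Rightarrow> (nat \<Rightarrow> nat) \<Rightarrow> bool" where
  "line_cycle k m \<longleftrightarrow> range m \<subseteq> {1..12} \<and> (\<forall>a b. m a = m b \<longleftrightarrow> [a = b] (mod k)) \<and>
     (\<forall>j. \<exists>B\<in>hesse_blocks. \<forall>a. m a \<in> B \<longleftrightarrow> [a = j] (mod k) \<or> [a = Suc j] (mod k))"

lemma levi_edge_iff:
  "{Inl p, Inr l} \<in> snd (levi_graph L) \<longleftrightarrow> p \<in> Sing L \<and> l \<in> L \<and> p \<subseteq> l"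
  by (auto simp: levi_graph_def doubleton_eq_iff)

lemma levi_edge_isl: "{u, v} \<in> snd (levi_graph L) \<Longrightarrow> isl v \<longleftrightarrow> \<not> isl u"
  by (auto simp: levi_graph_def doubleton_eq_iff)

lemma cong_Suc_iff: "[Suc a = Suc b] (mod k) \<longleftrightarrow> [a = b] (mod k)"
  using cong_add_rcancel_nat[of a 1 b k] by simp

text \<open>Lines and points occupy the two parity classes of positions modulo \<open>2 * k\<close>;
  inside the class of \<open>s\<close> the index is determined modulo \<open>k\<close>.\<close>

lemma cong_add_double_iff:
  fixes a b k s :: nat
  shows "[s + 2 * a = s + 2 * b] (mod 2 * k) \<longleftrightarrow> [a = b] (mod k)"
  unfolding cong_add_lcancel_nat by (simp add: cong_def flip: mult_mod_right)

text \<open>The Levi graph is bipartite, so every second vertex of the cycle is a line. The point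
  between two successive lines supplies the block, and no third line of the sequence passes through
  it because an induced cycle has no chord.\<close>

lemma line_cycle_of_induced_cycle:
  assumes lin: "bij_betw lin {1..12} L"
    and pts: "bij_betw (\<lambda>p. {i \<in> {1..12}. p \<subseteq> lin i}) (Sing L) hesse_blocks"
    and cyc: "induced_cycle (levi_graph L) W"
  obtains k m where "card W = 2 * k" "line_cycle k m"
proof -
  obtain n f where n: "3 \<le> n" and f: "bij_betw f {..<n} W"
    and E: "{e \<in> snd (levi_graph L). e \<subseteq> W} = {{f i, f (Suc i mod n)} | i. i < n}"
    using cyc by (auto simp: induced_cycle_def is_cycle_def induced_subgraph_def)
  \<comment> \<open>The periodic extension of \<open>f\<close> replaces wrap-around cases by
    congruences modulo \<open>n\<close>.\<close>
  define F where "F i = f (i mod n)" for i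
  have F_eq: "F i = F j \<longleftrightarrow> [i = j] (mod n)" for i j
    using bij_betw_imp_inj_on[OF f] n by (auto simp: F_def cong_def inj_on_eq_iff)
  have FW: "F i \<in> W" for i
    using bij_betwE[OF f] n by (simp add: F_def)
  have edge: "{F i, F (Suc i)} \<in> snd (levi_graph L)" for i
  proof -
    have "{f (i mod n), f (Suc (i mod n) mod n)} \<in> {{f i, f (Suc i mod n)} | i. i < n}"
      using n by (auto intro!: exI[of _ "i mod n"])
    then show ?thesis
      unfolding E[symmetric] by (simp add: F_def mod_Suc_eq)
  qed
  \<comment> \<open>This is the absence of chords: by \<open>E\<close>, an edge inside
    \<open>W\<close> is an edge of the cycle.\<close>
  have consecutive: "[j = Suc i] (mod n) \<or> [i = Suc j] (mod n)"
    if "{F i, F j} \<in> snd (levi_graph L)" for i j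
  proof -
    have "{F i, F j} \<in> {{f i, f (Suc i mod n)} | i. i < n}"
      unfolding E[symmetric] using that FW by simp
    then obtain t where "t < n" "{F i, F j} = {f t, f (Suc t mod n)}" by blast
    then have "{F i, F j} = {F t, F (Suc t)}" by (simp add: F_def)
    then have "[i = t] (mod n) \<and> [j = Suc t] (mod n) \<or> [j = t] (mod n) \<and> [i = Suc t] (mod n)"
      unfolding doubleton_eq_iff F_eq by blast
    then show ?thesis
      by (metis cong_Suc_iff cong_sym cong_trans)
  qed
  have alt: "isl (F (Suc i)) \<longleftrightarrow> \<not> isl (F i)" for i
    using levi_edge_isl[OF edge] .
  have parity: "isl (F i) \<longleftrightarrow> (isl (F 0) \<longleftrightarrow> even i)" for i
    by (induction i) (auto simp: alt)
  \<comment> \<open>One full turn returns to the same side of the bipartition.\<close>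
  have "F n = F 0" by (simp add: F_def)
  then have "even n" using parity[of n] by auto
  then obtain k where k: "n = 2 * k" ..
  \<comment> \<open>If the cycle starts at a point, the shift by one moves to a line; positions
    \<open>s + 2 * a\<close> then hold lines and their successors hold points.\<close>
  define s :: nat where "s = (if isl (F 0) then 1 else 0)"
  define l where "l a = projr (F (s + 2 * a))" for a
  define p where "p a = projl (F (Suc (s + 2 * a)))" for a
  have l: "F (s + 2 * a) = Inr (l a)" for a
    unfolding l_def using parity[of "s + 2 * a"] by (intro sum.collapse(2)[symmetric]) (auto simp: s_def)
  have p: "F (Suc (s + 2 * a)) = Inl (p a)" for a
    unfolding p_def using parity[of "Suc (s + 2 * a)"] by (intro sum.collapse(1)[symmetric]) (auto simp: s_def)
  have incident: "p j \<in> Sing L \<and> l a \<in> L \<and> p j \<subseteq> l a \<longleftrightarrow> [a = j] (mod k) \<or> [a = Suc j] (mod k)"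
    for a j
  proof -
    have same: "p j \<in> Sing L \<and> l j \<in> L \<and> p j \<subseteq> l j" for j
      using edge[of "s + 2 * j"] unfolding l p by (simp add: levi_edge_iff insert_commute)
    have step: "p j \<in> Sing L \<and> l (Suc j) \<in> L \<and> p j \<subseteq> l (Suc j)" for j
      using edge[of "Suc (s + 2 * j)"] l[of "Suc j"] unfolding p by (simp add: levi_edge_iff)
    have l_eq: "l a = l b" if "[a = b] (mod k)" for a b
      using that F_eq[of "s + 2 * a" "s + 2 * b"] unfolding l k cong_add_double_iff by simp
    show ?thesis
    proof
      assume "p j \<in> Sing L \<and> l a \<in> L \<and> p j \<subseteq> l a"
      then have "{F (Suc (s + 2 * j)), F (s + 2 * a)} \<in> snd (levi_graph L)"
        unfolding l p by (simp add: levi_edge_iff)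
      then have "[s + 2 * a = s + 2 * Suc j] (mod n) \<or> [Suc (s + 2 * j) = Suc (s + 2 * a)] (mod n)"
        by (auto dest: consecutive)
      then show "[a = j] (mod k) \<or> [a = Suc j] (mod k)"
        unfolding k cong_add_double_iff cong_Suc_iff by (auto simp: cong_sym_eq)
    next
      assume "[a = j] (mod k) \<or> [a = Suc j] (mod k)"
      then show "p j \<in> Sing L \<and> l a \<in> L \<and> p j \<subseteq> l a"
        using same[of j] step[of j] l_eq by auto
    qed
  qed
  have lL: "l a \<in> L" and pS: "p a \<in> Sing L" for a
    using incident[of a a] by auto
  define m where "m a = inv_into {1..12} lin (l a)" for a
  have m: "m a \<in> {1..12}" "lin (m a) = l a" for a
    unfolding m_def using lL[of a] bij_betw_imp_surj_on[OF lin]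
    by (blast intro: inv_into_into, intro bij_betw_inv_into_right[OF lin])
  have "m a = m b \<longleftrightarrow> [a = b] (mod k)" for a b
  proof -
    have "m a = m b \<longleftrightarrow> l a = l b"
      using m by (metis m_def)
    also have "\<dots> \<longleftrightarrow> F (s + 2 * a) = F (s + 2 * b)" by (simp add: l)
    finally show ?thesis unfolding F_eq k cong_add_double_iff .
  qed
  moreover have "\<exists>B\<in>hesse_blocks. \<forall>a. m a \<in> B \<longleftrightarrow> [a = j] (mod k) \<or> [a = Suc j] (mod k)" for j
  proof (rule bexI)
    show "{i \<in> {1..12}. p j \<subseteq> lin i} \<in> hesse_blocks"
      using bij_betwE[OF pts] pS by blast
    show "\<forall>a. m a \<in> {i \<in> {1..12}. p j \<subseteq> lin i} \<longleftrightarrow> [a = j] (mod k) \<or> [a = Suc j] (mod k)"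
      using m incident lL pS by simp
  qed
  ultimately have "line_cycle k m"
    using m by (auto simp only: line_cycle_def)
  moreover have "card W = 2 * k"
    using bij_betw_same_card[OF f] k by simp
  ultimately show ?thesis using that by blast
qed

text \<open>Lines alternate with the points where successive lines meet. There is no chord, since
  each such point lies on no third line of the sequence; \<open>3 \<le> k\<close> keeps the points
  distinct.\<close>

lemma induced_cycle_of_line_cycle:
  assumes lin: "bij_betw lin {1..12} L"
    and pts: "bij_betw (\<lambda>p. {i \<in> {1..12}. p \<subseteq> lin i}) (Sing L) hesse_blocks"
    and cyc: "line_cycle k m" and k: "3 \<le> k"
  obtains W where "induced_cycle (levi_graph L) W" "card W = 2 * k"
proof -
  let ?I = "\<lambda>p. {i \<in> {1..12}. p \<subseteq> lin i}"
  have m_range: "m a \<in> {1..12}" and m_eq: "m a = m b \<longleftrightarrow> [a = b] (mod k)" for a b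
    using cyc by (auto simp only: line_cycle_def)
  obtain B where B: "B j \<in> hesse_blocks"
    "m a \<in> B j \<longleftrightarrow> [a = j] (mod k) \<or> [a = Suc j] (mod k)" for a j
    using cyc unfolding line_cycle_def by metis
  \<comment> \<open>The blocks \<open>B j\<close> are arbitrary choices and need not be periodic in
    \<open>j\<close>; reducing the index makes \<open>p\<close> periodic.\<close>
  define p where "p j = inv_into (Sing L) ?I (B (j mod k))" for j
  have pS: "p j \<in> Sing L" for j
    unfolding p_def by (rule inv_into_into) (use B(1) bij_betw_imp_surj_on[OF pts] in blast)
  have Ip: "?I (p j) = B (j mod k)" for j
    unfolding p_def by (rule bij_betw_inv_into_right[OF pts B(1)])
  have lL: "lin (m a) \<in> L" for a
    using bij_betwE[OF lin] m_range by blast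
  have incident: "p j \<subseteq> lin (m a) \<longleftrightarrow> [a = j] (mod k) \<or> [a = Suc j] (mod k)" for a j
  proof -
    have "p j \<subseteq> lin (m a) \<longleftrightarrow> m a \<in> ?I (p j)" using m_range by simp
    then show ?thesis
      unfolding Ip B(2) by (simp add: cong_def mod_Suc_eq)
  qed
  have l_eq: "lin (m a) = lin (m b) \<longleftrightarrow> [a = b] (mod k)" for a b
    using bij_betw_imp_inj_on[OF lin] m_range by (simp add: inj_on_eq_iff m_eq)
  have p_eq: "p a = p b \<longleftrightarrow> [a = b] (mod k)" for a b
  proof
    assume eq: "p a = p b"
    have "[a = b] (mod k) \<or> [a = Suc b] (mod k)" "[Suc a = b] (mod k) \<or> [Suc a = Suc b] (mod k)"
      using incident[of a a] incident[of a "Suc a"] unfolding eq incident by auto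
    \<comment> \<open>Distinct indices with the same point would be successors of each other, so
      that \<open>k\<close> divides 2.\<close>
    moreover have False if "[a = Suc b] (mod k)" "[Suc a = b] (mod k)"
    proof -
      have "[Suc (Suc b) = b] (mod k)"
        using cong_trans[OF cong_sym[OF cong_Suc_iff[THEN iffD2, OF that(1)]] that(2)] .
      then have "[b + 2 = b + 0] (mod k)" by simp
      then have "[2 = 0::nat] (mod k)" unfolding cong_add_lcancel_nat .
      then show False using k by (simp add: cong_def)
    qed
    ultimately show "[a = b] (mod k)" unfolding cong_Suc_iff by blast
  qed (simp add: p_def cong_def)
  define f where "f i = (if even i then Inr (lin (m (i div 2))) else Inl (p (i div 2)))" for i
  have f_even: "f (2 * a) = Inr (lin (m a))" and f_odd: "f (Suc (2 * a)) = Inl (p a)" for a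
    by (simp_all add: f_def)
  have f_eq: "f i = f j \<longleftrightarrow> [i = j] (mod 2 * k)" for i j
  proof -
    have par: "even i \<longleftrightarrow> even j" if "[i = j] (mod 2 * k)"
      using that cong_dvd_iff cong_dvd_modulus_nat dvd_triv_left by blast
    consider a b where "i = 2 * a" "j = 2 * b" | a b where "i = Suc (2 * a)" "j = Suc (2 * b)"
      | "even i \<noteq> even j"
      by (cases "even i"; cases "even j") (auto elim!: evenE oddE)
    then show ?thesis
    proof cases
      case 1
      then show ?thesis using cong_add_double_iff[of 0 a b k] by (simp add: f_even l_eq)
    next
      case 2
      then show ?thesis using cong_add_double_iff[of 1 a b k] by (simp add: f_odd p_eq)
    next
      case 3
      then show ?thesis using par by (auto simp: f_def)
    qed
  qed
  have f_mod: "f (i mod (2 * k)) = f i" for i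
    by (simp add: f_eq)
  define W where "W = range f"
  have W: "W = f ` {..<2 * k}"
    unfolding W_def using f_mod k by (auto intro!: image_eqI[of _ f "_ mod (2 * k)"])
  have bij: "bij_betw f {..<2 * k} W"
    unfolding W by (intro bij_betw_imageI inj_onI) (auto simp: f_eq cong_def)
  have edge: "{f i, f (Suc i)} \<in> snd (levi_graph L)" for i
  proof (cases "even i")
    case True
    then obtain a where "i = 2 * a" ..
    then show ?thesis
      using f_even[of a] f_odd[of a] pS lL incident[of a a]
      by (simp add: insert_commute[of "Inr _"] levi_edge_iff)
  next
    case False
    then obtain a where i: "i = Suc (2 * a)" by (metis oddE Suc_eq_plus1)
    then have "f (Suc i) = Inr (lin (m (Suc a)))" using f_even[of "Suc a"] by simp
    then show ?thesis
      using i f_odd[of a] pS lL incident[of a "Suc a"] by (simp add: levi_edge_iff)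
  qed
  have "{e \<in> snd (levi_graph L). e \<subseteq> W} = {{f i, f (Suc i mod (2 * k))} | i. i < 2 * k}" (is "?E = ?C")
  proof (intro equalityI subsetI)
    fix e assume "e \<in> ?C"
    then show "e \<in> ?E" using edge by (auto simp: f_mod W_def)
  next
    fix e assume e: "e \<in> ?E"
    then obtain q l where ql: "e = {Inl q, Inr l}" "q \<subseteq> l" "Inl q \<in> W" "Inr l \<in> W"
      by (auto simp: levi_graph_def)
    then obtain a b where ab: "q = p a" "l = lin (m b)"
      by (auto simp: W_def f_def split: if_splits)
    \<comment> \<open>An incidence inside \<open>W\<close> links the point \<open>p a\<close> only
      to its two neighbours on the cycle.\<close>
    then consider "[b = a] (mod k)" | "[b = Suc a] (mod k)" using ql incident by blast
    then obtain i where "e = {f i, f (Suc i)}"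
    proof cases
      case 1
      then have "e = {f (2 * a), f (Suc (2 * a))}"
        using ql ab l_eq by (auto simp: f_even f_odd)
      then show ?thesis by (rule that)
    next
      case 2
      then have "e = {f (Suc (2 * a)), f (2 * Suc a)}"
        unfolding f_even f_odd using ql ab l_eq by auto
      then show ?thesis using that by simp
    qed
    then have "e = {f (i mod (2 * k)), f (Suc (i mod (2 * k)) mod (2 * k))}"
      by (simp add: f_mod mod_Suc_eq)
    then show "e \<in> ?C" using k by (auto intro!: exI[of _ "i mod (2 * k)"])
  qed
  then have "is_cycle (induced_subgraph (levi_graph L) W)"
    using bij k unfolding is_cycle_def induced_subgraph_def by (intro exI[of _ "2 * k"] exI[of _ f]) simp
  moreover have "W \<subseteq> fst (levi_graph L)"
    using pS lL by (auto simp: W_def f_def levi_graph_def)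
  ultimately show ?thesis
    using that bij_betw_same_card[OF bij] by (simp add: induced_cycle_def)
qed

section \<open>Cycles through three to six lines\<close>

text \<open>The points used are the double points of the pairs 12, 23, 45, 56, the point on 3, 4, 8,
  9, and the point closing the cycle on lines \<open>k\<close> and 1. Any further line through one
  of these has index at least 7.\<close>

lemma initial_lines_check: "list_all (\<lambda>k. list_all (\<lambda>j. list_ex (\<lambda>b.
    set b \<inter> set [1..<Suc k] = {Suc j, Suc (Suc j mod k)}) (map fst hpoints)) [0..<k]) [3..<7]"
  by code_simp

lemma line_cycle_initial_lines:
  assumes "3 \<le> k" "k \<le> 6" shows "line_cycle k (\<lambda>i. Suc (i mod k))"
proof -
  have range: "Suc (i mod k) \<in> set [1..<Suc k]" for i
    using mod_less_divisor[of k i] assms unfolding set_upt by (intro atLeastLessThan_iff[THEN iffD2]) linarith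
  have "\<exists>B\<in>hesse_blocks. \<forall>a. Suc (a mod k) \<in> B \<longleftrightarrow> [a = j] (mod k) \<or> [a = Suc j] (mod k)" for j
  proof -
    have "k \<in> set [3..<7]" "j mod k \<in> set [0..<k]" using assms by auto
    then obtain b where b: "b \<in> set (map fst hpoints)"
      "set b \<inter> set [1..<Suc k] = {Suc (j mod k), Suc (Suc (j mod k) mod k)}"
      using initial_lines_check unfolding list_all_iff list_ex_iff by blast
    have "Suc (a mod k) \<in> set b \<longleftrightarrow> [a = j] (mod k) \<or> [a = Suc j] (mod k)" for a
    proof -
      have "Suc (a mod k) \<in> set b \<longleftrightarrow> Suc (a mod k) \<in> set b \<inter> set [1..<Suc k]"
        using range by blast
      then show ?thesis unfolding b(2) by (simp add: cong_def mod_Suc_eq)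
    qed
    moreover have "set b \<in> hesse_blocks" using b(1) by (auto simp flip: hblock_set)
    ultimately show ?thesis by blast
  qed
  moreover have "range (\<lambda>i. Suc (i mod k)) \<subseteq> {1..12}"
  proof -
    have "Suc (i mod k) \<le> 12" for i using mod_less_divisor[of k i] assms by linarith
    then show ?thesis by auto
  qed
  ultimately show ?thesis
    by (simp add: line_cycle_def cong_def)
qed

section \<open>Excluding seven or more lines by exhaustive search\<close>

text \<open>Lets the search assume that a cycle starts at its line of smallest index.\<close>

lemma line_cycle_shift: "line_cycle k m \<Longrightarrow> line_cycle k (\<lambda>i. m (i + c))"
  unfolding line_cycle_def
proof (elim conjE, intro conjI allI)
  fix j assume "\<forall>j. \<exists>B\<in>hesse_blocks. \<forall>a. m a \<in> B \<longleftrightarrow> [a = j] (mod k) \<or> [a = Suc j] (mod k)"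
  then obtain B where B: "B \<in> hesse_blocks"
    "\<And>a. m a \<in> B \<longleftrightarrow> [a = j + c] (mod k) \<or> [a = Suc j + c] (mod k)"
    by (metis add_Suc)
  show "\<exists>B\<in>hesse_blocks. \<forall>a. m (a + c) \<in> B \<longleftrightarrow> [a = j] (mod k) \<or> [a = Suc j] (mod k)"
    using B(1) B(2)[of "_ + c"] unfolding cong_add_rcancel_nat by blast
qed (auto simp only: cong_add_rcancel_nat)

text \<open>Entry \<open>x\<close> lists the singular points on line \<open>x\<close>, each as the list of the other lines
  through it; entry 0 is empty.\<close>

definition hesse_pencils :: "nat list list list" where
  "hesse_pencils = map (\<lambda>x. map (filter ((\<noteq>) x)) (filter (\<lambda>b. x \<in> set b) (map fst hpoints))) [0..<13]"

text \<open>Depth-first search of depth \<open>n\<close> for a cycle of at least seven lines: \<open>x # xs\<close> is the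
  path so far, latest line first, and \<open>A\<close> contains the lines that may still be used. The table
  is an argument, and \<open>if\<close> replaces the propositional connectives, for the sake of \<open>code_simp\<close>:
  it then evaluates the table only once and skips the irrelevant branches.\<close>

primrec no_cycle :: "nat list list list \<Rightarrow> nat \<Rightarrow> nat \<Rightarrow> nat list \<Rightarrow> nat list \<Rightarrow> bool" where
  "no_cycle T 0 x xs A \<longleftrightarrow> False"
| "no_cycle T (Suc n) x xs A \<longleftrightarrow> list_all (\<lambda>b.
     if list_all (\<lambda>z. z \<notin> set b) xs
     then (let A' = filter (\<lambda>z. z \<notin> set b) A
           in list_all (\<lambda>y. if y \<in> set A then no_cycle T n y (x # xs) A' else True) b)
     else if length xs < 6 then True
     else filter (\<lambda>z. z \<in> set b) xs \<noteq> [last xs]) (T ! x)"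

text \<open>Only lines larger than the start \<open>s\<close> are offered. Exhausted depth counts as
  failure, so the bound 9 cannot hide a cycle: the evaluation itself shows that no path reaches
  it.\<close>

lemma no_cycle_check: "list_all (\<lambda>s. no_cycle hesse_pencils 9 s [] [Suc s..<13]) [1..<13]"
  by code_simp

text \<open>A given cycle \<open>m\<close> is followed down the search tree: its lines up to
  \<open>m j\<close> form the path, and \<open>A\<close> still contains all its later lines. The
  branch along \<open>m\<close> cannot be pruned and ends in a closed cycle, which the search
  rejects.\<close>

lemma no_cycle_sound:
  assumes cyc: "line_cycle k m" and k: "7 \<le> k" and "j < k"
    and "no_cycle hesse_pencils n (m j) (rev (map m [0..<j])) A"
    and "\<And>i. j < i \<Longrightarrow> i < k \<Longrightarrow> m i \<in> set A"
  shows False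
  using assms(3-)
proof (induction n arbitrary: j A)
  case 0
  then show ?case by simp
next
  case (Suc n)
  let ?xs = "rev (map m [0..<j])"
  have m_eq: "m a = m b \<longleftrightarrow> a mod k = b mod k" and m_range: "m a \<in> {1..12}" for a b
    using cyc by (auto simp only: line_cycle_def cong_def)
  obtain B where B: "B \<in> hesse_blocks" "m a \<in> B \<longleftrightarrow> a mod k = j mod k \<or> a mod k = Suc j mod k" for a
    using cyc unfolding line_cycle_def cong_def by metis
  obtain b where b: "b \<in> set (hesse_pencils ! m j)" "set b = B - {m j}"
  proof -
    obtain b' where b': "b' \<in> set (map fst hpoints)" "set b' = B"
      using B(1) by (auto simp flip: hblock_set)
    have "hesse_pencils ! m j =
        map (filter ((\<noteq>) (m j))) (filter (\<lambda>b. m j \<in> set b) (map fst hpoints))"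
      unfolding hesse_pencils_def using m_range[of j] by (subst nth_map) auto
    then have "filter ((\<noteq>) (m j)) b' \<in> set (hesse_pencils ! m j)"
      using b' B(2)[of j] by simp
    then show ?thesis by (rule that) (use b' in auto)
  qed
  have m_b: "m a \<in> set b \<longleftrightarrow> a mod k = Suc j mod k" for a
  proof -
    have "j mod k \<noteq> Suc j mod k" using k by (simp add: mod_Suc)
    then show ?thesis unfolding b(2) using B(2) m_eq by auto
  qed
  have step: "if list_all (\<lambda>z. z \<notin> set b) ?xs
     then (let A' = filter (\<lambda>z. z \<notin> set b) A
           in list_all (\<lambda>y. if y \<in> set A then no_cycle hesse_pencils n y (m j # ?xs) A' else True) b)
     else if length ?xs < 6 then True
     else filter (\<lambda>z. z \<in> set b) ?xs \<noteq> [last ?xs]"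
    using Suc.prems(2) b(1) unfolding no_cycle.simps list_all_iff by blast
  show False
  proof (cases "Suc j < k")
    case True
    \<comment> \<open>The only line of the cycle in \<open>b\<close> is \<open>m (Suc j)\<close>,
      which is not yet on the path.\<close>
    then have "list_all (\<lambda>z. z \<notin> set b) ?xs"
      by (simp add: list_all_iff m_b)
    then have "\<forall>y\<in>set b. y \<in> set A \<longrightarrow>
        no_cycle hesse_pencils n y (m j # ?xs) (filter (\<lambda>z. z \<notin> set b) A)"
      using step by (simp add: list_all_iff)
    then have "no_cycle hesse_pencils n (m (Suc j)) (m j # ?xs) (filter (\<lambda>z. z \<notin> set b) A)"
      using Suc.prems(3)[of "Suc j"] True m_b by simp
    \<comment> \<open>For the same reason, removing the lines of \<open>b\<close> from
      \<open>A\<close> loses no line of the cycle after \<open>m (Suc j)\<close>.\<close>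
    then show False
      using True Suc.prems(3) by (intro Suc.IH[of "Suc j"]) (auto simp: m_b)
  next
    case False
    \<comment> \<open>The last point joins \<open>m j\<close> back to \<open>m 0\<close>, the last
      entry of the reversed path. As \<open>7 \<le> k\<close>, the path behind \<open>m j\<close>
      has at least six lines, so the closing test applies.\<close>
    then have j: "k = Suc j" using Suc.prems(1) by simp
    have "[0..<j] = 0 # [1..<j]" using j k by (simp add: upt_conv_Cons)
    moreover have "filter (\<lambda>z. z \<in> set b) (map m [1..<j]) = []"
      by (auto simp: filter_empty_conv m_b j)
    ultimately have "filter (\<lambda>z. z \<in> set b) ?xs = [m 0]" "last ?xs = m 0" "m 0 \<in> set ?xs"
      by (auto simp: m_b j simp flip: rev_filter)
    then show False
      using step m_b[of 0] j k by (auto simp: list_all_iff split: if_splits)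
  qed
qed

lemma line_cycle_length:
  assumes "line_cycle k m" shows "k \<le> 6"
proof (rule ccontr)
  assume "\<not> k \<le> 6"
  \<comment> \<open>The cycle is rotated to begin at its smallest line, as the search
    expects.\<close>
  obtain c where c: "m c \<le> m a" for a
    using ex_has_least_nat[of "\<lambda>_. True" 0 m] by auto
  define m' where "m' i = m (i + c)" for i
  have m': "line_cycle k m'"
    unfolding m'_def using assms by (rule line_cycle_shift)
  have range: "m' a \<in> {1..12}" and m'_eq: "m' a = m' b \<longleftrightarrow> a mod k = b mod k" for a b
    using m' by (auto simp only: line_cycle_def cong_def)
  have "no_cycle hesse_pencils 9 (m' 0) [] [Suc (m' 0)..<13]"
  proof -
    have "m' 0 \<in> set [1..<13]" unfolding set_upt using range[of 0] by auto
    then show ?thesis using no_cycle_check unfolding list_all_iff by blast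
  qed
  moreover have "m' i \<in> set [Suc (m' 0)..<13]" if "0 < i" "i < k" for i
  proof -
    have "m' 0 \<le> m' i" using c by (simp add: m'_def)
    moreover have "m' 0 \<noteq> m' i" using that by (simp add: m'_eq)
    ultimately show ?thesis using range[of i] by simp
  qed
  ultimately show False
    using \<open>\<not> k \<le> 6\<close> by (intro no_cycle_sound[OF m', of 0 9]) auto
qed

theorem theorem4p10:
  fixes L :: "projective_set set"
  assumes "hesse_arrangement L"
  shows "(\<forall>i::nat. 3 \<le> i \<and> i \<le> 6 \<longrightarrow> (\<exists>W. induced_cycle (levi_graph L) W \<and> card W = 2 * i)) \<and>
         (\<exists>W. longest_induced_cycle (levi_graph L) W \<and> card W = 12)"
proof -
  obtain lin where lin: "bij_betw lin {1..12} L"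
    and pts: "bij_betw (\<lambda>p. {i \<in> {1..12}. p \<subseteq> lin i}) (Sing L) hesse_blocks"
    using assms unfolding hesse_arrangement_def by blast
  have short: "\<exists>W. induced_cycle (levi_graph L) W \<and> card W = 2 * i" if "3 \<le> i" "i \<le> 6" for i
    using induced_cycle_of_line_cycle[OF lin pts line_cycle_initial_lines] that by metis
  have "card W \<le> 12" if cyc: "induced_cycle (levi_graph L) W" for W
  proof -
    obtain k m where "card W = 2 * k" "line_cycle k m"
      using line_cycle_of_induced_cycle[OF lin pts cyc] .
    then show ?thesis using line_cycle_length[of k m] by simp
  qed
  then have "\<exists>W. longest_induced_cycle (levi_graph L) W \<and> card W = 12"
    using short[of 6] unfolding longest_induced_cycle_def by fastforce
  with short show ?thesis by blast
qed

end
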